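(* Let $n\geq 8$ and $a$ be integers with $2\leq a<\frac{n}{2}$ and $(n,a)\neq(8,3)$, and let $\overline{\Gamma}=\overline{C_n(1,a)}$ be the complement of the circulant graph $C_n(1,a)$. Then its edge-forwarding index satisfies $$\frac{2(n+3)}{n-5}\leq \pi(\overline{\Gamma})\leq 14.$$
   Context: For $S\subseteq\mathbb{Z}_n\setminus\{0\}$, the circulant graph $C_n(S)$ is the simple undirected graph with vertex set $\mathbb{Z}_n=\{0,1,\ldots,n-1\}$ and edge set $\{\{g,g+s\}: g\in\mathbb{Z}_n, s\in S\}$ (addition mod $n$); $C_n(1,a)$ means $C_n(\{1,a\})$. $\overline{\Gamma}$ denotes the complement of $\Gamma$. A routing $R$ of a connected graph $\Gamma$ on $n$ vertices is a set of $n(n-1)$ elementary (i.e. simple) paths $R(x,y)$, one from $x$ to $y$ for every ordered pair $(x,y)$ of distinct vertices. The load of an edge $e$ in $R$ is the number of paths of $R$ passing through $e$ (in either direction), and $\pi(\Gamma,R)$ is the maximum load over all edges of $\Gamma$. The edge-forwarding index is $\pi(\Gamma)=\min_R\pi(\Gamma,R)$, the minimum over all routings $R$ of $\Gamma$. *)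

theory Defs
  imports Complex_Main "Graph_Theory.Graph_Theory"
begin

text \<open>
  A simple undirected graph is represented as in the Graph_Theory library: a symmetric loop-free
  digraph (locale \<^locale>\<open>pair_graph\<close>) in which an undirected edge \<open>{u, v}\<close> is the pair of arcs
  \<open>(u, v)\<close> and \<open>(v, u)\<close>.
\<close>

text \<open>
  The residues modulo \<open>n\<close> are represented by \<open>0, \<dots>, n - 1\<close>; the connection set \<open>S\<close> is meant to be a
  subset of \<open>{1..<n}\<close>.  It need not be closed under negation, so both arcs are added for each step.
\<close>

definition circulant_graph :: "nat \<Rightarrow> nat set \<Rightarrow> nat pair_pre_digraph" where
  "circulant_graph n S =
    \<lparr> pverts = {0..<n},
      parcs = (\<Union>g\<in>{0..<n}. \<Union>s\<in>S. {(g, (g + s) mod n), ((g + s) mod n, g)}) \<rparr>"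

definition complement_graph :: "'a pair_pre_digraph \<Rightarrow> 'a pair_pre_digraph" where
  "complement_graph G =
    \<lparr> pverts = pverts G,
      parcs = {(u, v). u \<in> pverts G \<and> v \<in> pverts G \<and> u \<noteq> v \<and> (u, v) \<notin> parcs G} \<rparr>"

definition undirected_edges :: "'a pair_pre_digraph \<Rightarrow> 'a set set" where
  "undirected_edges G = {{u, v} | u v. (u, v) \<in> parcs G}"

text \<open>
  A routing is a function on ordered pairs; its values on pairs \<open>(x, x)\<close> and outside the vertex
  set are irrelevant.
\<close>

definition routing :: "'a pair_pre_digraph \<Rightarrow> ('a \<Rightarrow> 'a \<Rightarrow> 'a vwalk) \<Rightarrow> bool" where
  "routing G R \<longleftrightarrow>
    (\<forall>x\<in>pverts G. \<forall>y\<in>pverts G. x \<noteq> y \<longrightarrow>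
      vpath (R x y) (with_proj G) \<and> hd (R x y) = x \<and> last (R x y) = y)"

definition edge_load ::
    "'a pair_pre_digraph \<Rightarrow> ('a \<Rightarrow> 'a \<Rightarrow> 'a vwalk) \<Rightarrow> 'a set \<Rightarrow> nat" where
  "edge_load G R e =
    card {(x, y). x \<in> pverts G \<and> y \<in> pverts G \<and> x \<noteq> y \<and>
                  (\<exists>(u, v) \<in> set (vwalk_arcs (R x y)). {u, v} = e)}"

definition max_edge_load :: "'a pair_pre_digraph \<Rightarrow> ('a \<Rightarrow> 'a \<Rightarrow> 'a vwalk) \<Rightarrow> nat" where
  "max_edge_load G R = Max (edge_load G R ` undirected_edges G)"

text \<open>
  The infimum is over natural numbers, so it is an attained minimum whenever a routing exists,
  i.e. whenever \<open>G\<close> is connected.  For a disconnected graph it would be the infimum of the empty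
  set, which is \<open>0\<close>.
\<close>

definition edge_forwarding_index :: "'a pair_pre_digraph \<Rightarrow> nat" where
  "edge_forwarding_index G = (INF R \<in> {R. routing G R}. max_edge_load G R)"

lemma edge_forwarding_index_attained:
  assumes "routing G R0"
  shows "\<exists>R. routing G R \<and> max_edge_load G R = edge_forwarding_index G"
    and "edge_forwarding_index G \<le> max_edge_load G R0"
proof -
  have "edge_forwarding_index G \<in> max_edge_load G ` {R. routing G R}"
    unfolding edge_forwarding_index_def using assms by (intro Inf_nat_def1) auto
  then show "\<exists>R. routing G R \<and> max_edge_load G R = edge_forwarding_index G"
    by auto
  show "edge_forwarding_index G \<le> max_edge_load G R0"
    unfolding edge_forwarding_index_def using assms by (intro cINF_lower) auto
qed

lemma pair_graph_circulant_graph: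
  assumes "S \<subseteq> {1..<n}"
  shows "pair_graph (circulant_graph n S)"
proof -
  have fin: "finite S"
    using assms finite_subset by blast
  have no_loop: "(g + s) mod n \<noteq> g" if "g < n" "s \<in> S" for g s
  proof -
    have "0 < s" "s < n"
      using that assms by auto
    then show ?thesis
      using that(1) by (cases "g + s < n") (auto simp: mod_if)
  qed
  show ?thesis
  proof
    show "symmetric (with_proj (circulant_graph n S))"
      unfolding symmetric_def by (auto simp: circulant_graph_def sym_def)
  next
    fix e assume "e \<in> parcs (circulant_graph n S)"
    then show "fst e \<noteq> snd e"
      using no_loop by (auto simp: circulant_graph_def dest: sym)
  qed (use fin in \<open>auto simp: circulant_graph_def\<close>)
qed

lemma pair_graph_complement_graph:
  assumes "pair_graph G"
  shows "pair_graph (complement_graph G)"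
proof -
  interpret pair_graph G by fact
  have "sym (parcs G)"
    using pair_sym_arcs by (simp add: symmetric_def)
  then have "symmetric (with_proj (complement_graph G))"
    unfolding symmetric_def by (auto simp: complement_graph_def sym_def)
  moreover have "finite (parcs (complement_graph G))"
    by (rule finite_subset[of _ "pverts G \<times> pverts G"])
      (auto simp: complement_graph_def pair_finite_verts)
  ultimately show ?thesis
    by unfold_locales (auto simp: complement_graph_def pair_finite_verts)
qed

end

theory Submission
  imports Defs
begin

text \<open>
  Both bounds come from looking at vertices of \<open>\<int>\<^sub>n\<close> through their differences.  Two distinct
  vertices are adjacent in \<open>C\<^sub>n(1, a)\<close> iff their difference lies in \<open>{\<plusminus>1, \<plusminus>a}\<close>, a set of four
  elements since \<open>2 \<le> a < n/2\<close>; so the complement is regular of degree \<open>n - 5\<close>, and each vertex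
  has four others at distance more than one.

  Lower bound (\<open>edge_load_lower_bound\<close>): a path between the ends of an edge uses at least one edge,
  any other path at least two.  The total load is therefore at least \<open>n(n - 5) + 2\<cdot>4n = n(n + 3)\<close>,
  and it is spread over \<open>n(n - 5)/2\<close> edges.

  Upper bound (\<open>exists_routing_complement_circulant\<close>): route adjacent pairs along their edge, and
  for each of the four differences \<open>s\<close> fix one decomposition \<open>s = t + r\<close> into two differences of the
  complement and use \<open>x, x + t, x + s\<close> for all \<open>x\<close>.  Such a decomposition exists because \<open>s\<close> and
  \<open>0\<close> lie both in \<open>{0, \<plusminus>1, \<plusminus>a}\<close> and in its reflection \<open>s - {0, \<plusminus>1, \<plusminus>a}\<close>, so that the two sets
  together cover at most \<open>8\<close> residues, which settles \<open>n \<ge> 9\<close>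
  (\<open>step_eq_sum_of_costeps\<close>); for \<open>n = 8\<close> only \<open>a = 2\<close> is left and the
  decompositions are explicit.  (For \<open>n = 8\<close>, \<open>a = 3\<close> the complement has only even differences and
  is disconnected.)  For one \<open>s\<close>, an edge can lie on at most three of the translated paths
  (\<open>two_step_load_one_difference\<close>), which gives a load of at most \<open>2 + 4\<cdot>3 = 14\<close>.

  The routing also serves the lower bound: the infimum defining the index is attained only because
  a routing exists.
\<close>

section \<open>The counting bound for the edge-forwarding index\<close>

lemma undirected_edges_eq_image:
  "undirected_edges G = (\<lambda>(u, v). {u, v}) ` parcs G"
  by (auto simp: undirected_edges_def)

lemma (in pair_graph) card_arcs_eq_twice_edges:
  "card (parcs G) = 2 * card (undirected_edges G)"
proof -
  have arc_rev: "(v, u) \<in> parcs G" if "(u, v) \<in> parcs G" for u v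
    using that pair_sym_arcs by (auto simp: symmetric_def sym_def)
  have fibre: "card {p \<in> parcs G. (case p of (u, v) \<Rightarrow> {u, v}) = e} = 2"
    if e: "e \<in> undirected_edges G" for e
  proof -
    obtain u v where uv: "e = {u, v}" "(u, v) \<in> parcs G"
      using e by (auto simp: undirected_edges_def)
    have "{p \<in> parcs G. (case p of (u, v) \<Rightarrow> {u, v}) = e} = {(u, v), (v, u)}"
      using uv arc_rev by (auto simp: doubleton_eq_iff)
    moreover have "u \<noteq> v"
      using uv(2) pair_no_loops by fastforce
    ultimately show ?thesis
      by simp
  qed
  have "card (parcs G) = (\<Sum>p\<in>parcs G. 1)"
    by simp
  also have "\<dots> = (\<Sum>e\<in>undirected_edges G. \<Sum>p\<in>{p \<in> parcs G. (case p of (u, v) \<Rightarrow> {u, v}) = e}. 1)"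
    unfolding undirected_edges_eq_image by (rule sum.image_gen) (rule pair_finite_arcs)
  also have "\<dots> = (\<Sum>e\<in>undirected_edges G. 2)"
    by (rule sum.cong) (simp_all add: fibre)
  finally show ?thesis
    by simp
qed

text \<open>
  Such a path has at least three vertices, and as they are distinct, its first two edges differ.
  The edges are given as sets because the load of an edge ignores the direction of traversal.
\<close>

lemma two_edges_on_nonadjacent_path:
  assumes path: "vpath p (with_proj G)" and ends: "hd p = x" "last p = y"
    and "x \<noteq> y" and nonadj: "(x, y) \<notin> parcs G"
  obtains e f where "e \<noteq> f" "{e, f} \<subseteq> undirected_edges G"
    "\<And>g. g \<in> {e, f} \<Longrightarrow> \<exists>(u, v) \<in> set (vwalk_arcs p). {u, v} = g"
proof -
  have walk: "set (vwalk_arcs p) \<subseteq> parcs G" "p \<noteq> []" and dist: "distinct p"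
    using path by (auto simp: vpath_def vwalk_def)
  obtain w z q where p: "p = x # w # z # q"
  proof (cases p rule: remdups_adj.cases)
    case (3 x' w q)
    then show ?thesis
      using that walk ends nonadj by (cases q) auto
  qed (use walk ends \<open>x \<noteq> y\<close> in auto)
  show ?thesis
  proof (rule that)
    show "{x, w} \<noteq> {w, z}"
      using dist p by (auto simp: doubleton_eq_iff)
    show "{{x, w}, {w, z}} \<subseteq> undirected_edges G"
      using walk p by (auto simp: undirected_edges_def)
  qed (auto simp: p)
qed

text \<open>
  Write \<open>N\<close>, \<open>A\<close>, \<open>E\<close> for the numbers of vertices, arcs and edges and \<open>M\<close> for the maximum load.
  Every ordered pair of distinct vertices satisfies \<open>2 \<le> (edges on its path) + [pair is an arc]\<close>.
  Summing over the pairs and exchanging the sums gives \<open>2 N (N - 1) \<le> E M + A\<close>, and \<open>A = 2 E\<close>.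
\<close>

lemma (in pair_graph) edge_load_lower_bound:
  assumes R: "routing G R"
  shows "4 * (card (pverts G) * (card (pverts G) - 1)) \<le> card (parcs G) * (max_edge_load G R + 2)"
proof -
  define P where "P = {(x, y). x \<in> pverts G \<and> y \<in> pverts G \<and> x \<noteq> y}"
  define E where "E = undirected_edges G"
  define uses where "uses = (\<lambda>(x, y) e. \<exists>(u, v) \<in> set (vwalk_arcs (R x y)). {u, v} = e)"
  have P_eq: "P = pverts G \<times> pverts G - (\<lambda>x. (x, x)) ` pverts G"
    by (auto simp: P_def)
  have cardP: "card P = card (pverts G) * (card (pverts G) - 1)"
    unfolding P_eq using pair_finite_verts
    by (subst card_Diff_subset)
      (auto simp: card_image inj_on_def card_cartesian_product diff_mult_distrib2)
  have finP: "finite P"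
    unfolding P_eq using pair_finite_verts by auto
  have finE: "finite E"
    unfolding E_def undirected_edges_eq_image using pair_finite_arcs by auto
  have arcs_P: "parcs G \<subseteq> P"
    using pair_no_loops in_arcsD1 in_arcsD2 by (fastforce simp: P_def)
  have load: "edge_load G R e = (\<Sum>p\<in>P. of_bool (uses p e))" for e
  proof -
    have "edge_load G R e = card {p \<in> P. uses p e}"
      unfolding edge_load_def P_def uses_def by (rule arg_cong[of _ _ card]) auto
    then show ?thesis
      using finP by (simp add: sum_of_bool_eq Int_def conj_commute)
  qed
  \<comment> \<open>An arc contributes one edge of its path and one for being an arc; any other pair contributes
    two edges of its path.\<close>
  have "2 \<le> (\<Sum>e\<in>E. of_bool (uses p e)) + (of_bool (p \<in> parcs G) :: nat)" if p: "p \<in> P" for p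
  proof -
    obtain x y where xy: "p = (x, y)" "x \<in> pverts G" "y \<in> pverts G" "x \<noteq> y"
      using p by (auto simp: P_def)
    have path: "vpath (R x y) (with_proj G)" "hd (R x y) = x" "last (R x y) = y"
      using R xy by (auto simp: routing_def)
    have count: "(\<Sum>e\<in>E. of_bool (uses p e)) = card {e \<in> E. uses p e}"
      using finE by (simp add: sum_of_bool_eq Int_def conj_commute)
    show ?thesis
    proof (cases "p \<in> parcs G")
      case True
      obtain u v where "(u, v) \<in> set (vwalk_arcs (R x y))"
      proof (cases "R x y" rule: remdups_adj.cases)
        case (3 u v q)
        then show ?thesis
          using that[of u v] by simp
      qed (use path xy in \<open>auto simp: vpath_def vwalk_def\<close>)
      then have "{u, v} \<in> {e \<in> E. uses p e}"
        using path(1) xy(1)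
        by (auto simp: E_def undirected_edges_def uses_def vpath_def vwalk_def)
      then have "{e \<in> E. uses p e} \<noteq> {}"
        by blast
      then have "0 < card {e \<in> E. uses p e}"
        using finE by (simp add: card_gt_0_iff)
      then show ?thesis
        using True count by simp
    next
      case False
      then obtain e f where ef: "e \<noteq> f" "{e, f} \<subseteq> undirected_edges G"
        "\<And>g. g \<in> {e, f} \<Longrightarrow> \<exists>(u, v) \<in> set (vwalk_arcs (R x y)). {u, v} = g"
        using two_edges_on_nonadjacent_path[OF path xy(4)] xy(1) by metis
      have "{e, f} \<subseteq> {e \<in> E. uses p e}"
        using ef(2,3) by (auto simp: E_def uses_def xy(1))
      then have "card {e, f} \<le> card {e \<in> E. uses p e}"
        using finE by (intro card_mono) auto
      then show ?thesis
        using ef(1) count by simp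
    qed
  qed
  then have "(\<Sum>p\<in>P. 2) \<le> (\<Sum>p\<in>P. (\<Sum>e\<in>E. of_bool (uses p e)) + (of_bool (p \<in> parcs G) :: nat))"
    by (rule sum_mono)
  also have "\<dots> = (\<Sum>e\<in>E. edge_load G R e) + card (parcs G)"
    using finP arcs_P
    by (simp add: sum.distrib sum.swap[of _ E] load sum_of_bool_eq Int_absorb1)
  also have "(\<Sum>e\<in>E. edge_load G R e) \<le> (\<Sum>e\<in>E. max_edge_load G R)"
    unfolding max_edge_load_def E_def[symmetric] using finE by (intro sum_mono) auto
  finally have "2 * card P \<le> card E * max_edge_load G R + card (parcs G)"
    by (simp add: mult.commute)
  then show ?thesis
    unfolding cardP card_arcs_eq_twice_edges E_def by (simp add: algebra_simps)
qed

section \<open>Circulant graphs and their complements in terms of differences\<close>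

text \<open>
  The differences between adjacent vertices of \<open>circulant_graph n S\<close>: the closure of \<open>S\<close> under
  negation modulo \<open>n\<close>.
\<close>

definition steps :: "nat \<Rightarrow> nat set \<Rightarrow> nat set" where
  "steps n S = S \<union> (\<lambda>s. n - s) ` S"

text \<open>The differences between adjacent vertices of the complement.\<close>

definition costeps :: "nat \<Rightarrow> nat set \<Rightarrow> nat set" where
  "costeps n S = {1..<n} - steps n S"

lemma add_mod_eq:
  "(x + d) mod n = (if x + d < n then x + d else x + d - n)" if "x < n" "d < n" for x d n :: nat
  using that by (simp add: mod_if)

lemma steps_bounds: "steps n S \<subseteq> {1..<n}" if "S \<subseteq> {1..<n}"
  using that by (fastforce simp: steps_def)

lemma parcs_circulant_graph:
  assumes S: "S \<subseteq> {1..<n}"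
  shows "parcs (circulant_graph n S)
    = (\<lambda>(x, d). (x, (x + d) mod n)) ` ({0..<n} \<times> steps n S)" (is "_ = ?f ` _")
proof (intro equalityI subsetI)
  fix p assume "p \<in> parcs (circulant_graph n S)"
  then obtain g s where gs: "g < n" "s \<in> S" "p = (g, (g + s) mod n) \<or> p = ((g + s) mod n, g)"
    by (auto simp: circulant_graph_def)
  have s: "1 \<le> s" "s < n"
    using S gs(2) by auto
  show "p \<in> ?f ` ({0..<n} \<times> steps n S)"
    using gs(3)
  proof
    assume "p = (g, (g + s) mod n)"
    then show ?thesis
      using gs by (auto simp: steps_def)
  next
    assume p: "p = ((g + s) mod n, g)"
    have "p = ?f ((g + s) mod n, n - s)"
      using p s gs(1) by (auto simp: add_mod_eq mod_if)
    then show ?thesis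
      using gs s by (intro rev_image_eqI[of "((g + s) mod n, n - s)"]) (auto simp: steps_def)
  qed
next
  fix p assume "p \<in> ?f ` ({0..<n} \<times> steps n S)"
  then obtain x d where xd: "x < n" "d \<in> steps n S" "p = (x, (x + d) mod n)"
    by auto
  from xd(2) consider "d \<in> S" | s where "s \<in> S" "d = n - s"
    by (auto simp: steps_def)
  then show "p \<in> parcs (circulant_graph n S)"
  proof cases
    case 1
    then show ?thesis
      using xd by (auto simp: circulant_graph_def)
  next
    case (2 s)
    then have "1 \<le> s" "s < n"
      using S by auto
    then have "x = ((x + d) mod n + s) mod n" "(x + d) mod n < n"
      using 2 xd(1) by (auto simp: mod_if)
    then show ?thesis
      using 2(1) xd(3) by (auto simp: circulant_graph_def)
  qed
qed

text \<open>
  The two lemmas on \<open>(x, d) \<mapsto> (x, x + d)\<close> make ordered pairs of vertices interchangeable with pairs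
  of a vertex and a difference, so that complementing the graph becomes complementing the set of
  differences.
\<close>

lemma translation_inj:
  "inj_on (\<lambda>(x, d). (x, (x + d) mod n)) ({0..<n} \<times> {0..<n})" for n :: nat
  by (auto simp: inj_on_def add_mod_eq split: if_splits)

lemma translation_onto:
  "(\<lambda>(x, d). (x, (x + d) mod n)) ` ({0..<n} \<times> {1..<n}) = {(x, y). x < n \<and> y < n \<and> x \<noteq> y}"
  for n :: nat
proof (intro equalityI subsetI)
  fix p assume "p \<in> {(x, y). x < n \<and> y < n \<and> x \<noteq> y}"
  then obtain x y where xy: "p = (x, y)" "x < n" "y < n" "x \<noteq> y"
    by auto
  let ?d = "if x < y then y - x else y + n - x"
  have "p = (x, (x + ?d) mod n)" "?d \<in> {1..<n}"
    using xy by (auto simp: mod_if)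
  then show "p \<in> (\<lambda>(x, d). (x, (x + d) mod n)) ` ({0..<n} \<times> {1..<n})"
    using xy(2) by (intro rev_image_eqI[of "(x, ?d)"]) auto
qed (auto simp: add_mod_eq split: if_splits)

lemma parcs_complement_circulant:
  assumes S: "S \<subseteq> {1..<n}"
  shows "parcs (complement_graph (circulant_graph n S))
    = (\<lambda>(x, d). (x, (x + d) mod n)) ` ({0..<n} \<times> costeps n S)" (is "_ = ?f ` _")
proof -
  have "parcs (complement_graph (circulant_graph n S))
      = {(x, y). x < n \<and> y < n \<and> x \<noteq> y} - parcs (circulant_graph n S)"
    by (auto simp: complement_graph_def circulant_graph_def)
  also have "\<dots> = ?f ` ({0..<n} \<times> {1..<n}) - ?f ` ({0..<n} \<times> steps n S)"
    by (simp only: translation_onto parcs_circulant_graph[OF S])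
  also have "\<dots> = ?f ` ({0..<n} \<times> {1..<n} - {0..<n} \<times> steps n S)"
    using steps_bounds[OF S]
    by (intro inj_on_image_set_diff[OF translation_inj, symmetric]) auto
  also have "{0..<n} \<times> {1..<n} - {0..<n} \<times> steps n S = {0..<n} \<times> costeps n S"
    by (auto simp: costeps_def)
  finally show ?thesis .
qed

lemma card_parcs_complement_circulant:
  assumes S: "S \<subseteq> {1..<n}"
  shows "card (parcs (complement_graph (circulant_graph n S))) = n * (n - 1 - card (steps n S))"
proof -
  have "inj_on (\<lambda>(x, d). (x, (x + d) mod n)) ({0..<n} \<times> costeps n S)"
    by (rule inj_on_subset[OF translation_inj]) (auto simp: costeps_def)
  moreover have "card (costeps n S) = n - 1 - card (steps n S)"
    unfolding costeps_def
    using steps_bounds[OF S] finite_subset[OF steps_bounds[OF S]]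
    by (subst card_Diff_subset) simp_all
  ultimately show ?thesis
    by (simp add: parcs_complement_circulant[OF S] card_image card_cartesian_product)
qed

section \<open>Two-step routings\<close>

text \<open>
  A summand \<open>t\<close> works iff neither \<open>t\<close> nor \<open>s - t\<close> lies in \<open>B = {0} \<union> steps n S\<close>, i.e. iff \<open>t\<close> avoids
  \<open>B\<close> and its reflection \<open>C = s - B\<close>.  The reflection exchanges \<open>0\<close> and \<open>s\<close>, both in \<open>B\<close>, so
  \<open>B \<inter> C\<close> has at least two elements and \<open>B \<union> C\<close> at most \<open>2 |B| - 2 = 2 |steps n S|\<close>.
\<close>

lemma step_eq_sum_of_costeps:
  assumes S: "S \<subseteq> {1..<n}" and small: "2 * card (steps n S) < n" and s: "s \<in> steps n S"
  shows "\<exists>t\<in>costeps n S. \<exists>r\<in>costeps n S. s = (t + r) mod n"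
proof -
  define B where "B = insert 0 (steps n S)"
  define C where "C = (\<lambda>b. (s + n - b) mod n) ` B"
  have bounds: "steps n S \<subseteq> {1..<n}"
    by (rule steps_bounds[OF S])
  then have fin: "finite (steps n S)"
    by (rule finite_subset) simp
  have s_bounds: "1 \<le> s" "s < n"
    using s bounds by auto
  have cardB: "card B = card (steps n S) + 1"
    unfolding B_def using fin bounds by (subst card_insert_disjoint) auto
  have finBC: "finite B" "finite C"
    using fin by (auto simp: B_def C_def)
  have "s \<in> C"
    unfolding C_def using s_bounds by (intro rev_image_eqI[of 0]) (auto simp: B_def)
  moreover have "0 \<in> C"
    unfolding C_def using s by (intro rev_image_eqI[of s]) (auto simp: B_def)
  ultimately have "{0, s} \<subseteq> B \<inter> C"
    using s by (auto simp: B_def)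
  then have "card {0, s} \<le> card (B \<inter> C)"
    using finBC by (intro card_mono) auto
  moreover have "card C \<le> card B"
    unfolding C_def using finBC by (intro card_image_le) auto
  moreover have "card B + card C = card (B \<union> C) + card (B \<inter> C)"
    by (rule card_Un_Int[OF finBC])
  ultimately have "card (B \<union> C) < card {0..<n}"
    using cardB small s_bounds by simp
  then have "\<not> {0..<n} \<subseteq> B \<union> C"
    using finBC card_mono[of "B \<union> C" "{0..<n}"] by auto
  then obtain t where t: "t < n" "t \<notin> B" "t \<notin> C"
    by (auto simp: subset_iff)
  define r where "r = (s + n - t) mod n"
  have "t = (s + n - r) mod n" "s = (t + r) mod n" "r < n"
    using t(1) s_bounds by (auto simp: r_def mod_if)
  moreover have "r \<notin> B"
    using t(3) calculation(1) by (auto simp: C_def)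
  ultimately show ?thesis
    using t by (intro bexI[of _ t] bexI[of _ r]) (auto simp: B_def costeps_def)
qed

text \<open>
  The path \<open>x, x + t, x + s\<close> can use the edge \<open>{u, v}\<close> only if \<open>x\<close> or \<open>x + t\<close> is \<open>u\<close> or \<open>v\<close>, which
  leaves the four start vertices \<open>u\<close>, \<open>v\<close>, \<open>u - t\<close> and \<open>v - t\<close>.  If all four occurred and were
  distinct, the edge would be the first step from \<open>u\<close> and from \<open>v\<close>, so \<open>u + t = v\<close> and \<open>v + t = u\<close>,
  and the second step from \<open>u - t\<close>, so \<open>u - t + s = v\<close>.  Then \<open>2 t = 0\<close> and \<open>s = 2 t = 0\<close>, which is
  excluded.
\<close>

lemma two_step_load_one_difference:
  fixes n s t u v :: nat
  assumes bounds: "0 < s" "s < n" "0 < t" "t < n" "u < n" "v < n"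
  shows "card {x \<in> {0..<n}. {x, (x + t) mod n} = {u, v}
      \<or> {(x + t) mod n, (x + s) mod n} = {u, v}} \<le> 3" (is "card ?X \<le> 3")
proof (rule ccontr)
  assume large: "\<not> card ?X \<le> 3"
  define shift_back where "shift_back = (\<lambda>w. if t \<le> w then w - t else w + n - t)"
  have preimage: "x = shift_back w" if "x < n" "(x + t) mod n = w" for x w
    using that bounds(4) by (auto simp: shift_back_def add_mod_eq split: if_splits)
  have image: "(shift_back w + t) mod n = w" "shift_back w < n" if "w < n" for w
    using that bounds(4) by (auto simp: shift_back_def add_mod_eq)
  define p q where "p = shift_back u" and "q = shift_back v"
  have sub: "?X \<subseteq> {u, v, p, q}"
    using preimage by (auto simp: doubleton_eq_iff p_def q_def)
  have "card ?X \<le> card {u, v, p, q}"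
    using sub by (intro card_mono) auto
  moreover have "card {u, v, p, q} \<le> 4"
    by (simp add: card_insert_if)
  ultimately have card4: "card ?X = 4" "card {u, v, p, q} = 4"
    using large by linarith+
  then have X: "?X = {u, v, p, q}"
    using sub by (intro card_subset_eq) auto
  have dist: "distinct [u, v, p, q]"
    using card4(2) by (intro card_distinct) simp
  have moves: "(x + d) mod n \<noteq> x" if "x < n" "0 < d" "d < n" for x d
    using that by (auto simp: add_mod_eq)
  have "u \<in> ?X" "v \<in> ?X" "p \<in> ?X"
    unfolding X by simp_all
  then have "(u + t) mod n = v" "(v + t) mod n = u" "(p + s) mod n = v"
    using dist image(1)[OF bounds(5)] moves[OF bounds(5)] moves[OF bounds(6)] bounds
    by (simp_all add: doubleton_eq_iff p_def)
  then show False
    using image[OF bounds(5)] bounds p_def by (auto simp: add_mod_eq split: if_splits)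
qed

text \<open>
  The two arcs of an edge account for a load of \<open>2\<close>.  Any other pair whose path uses the edge has a
  difference in \<open>steps n S\<close>, and each such difference contributes at most three start vertices.
  That the complement has an edge is assumed because the maximum over an empty set of edges is an
  unspecified number.
\<close>

lemma exists_routing_complement_circulant:
  assumes S: "S \<subseteq> {1..<n}" and nonempty: "costeps n S \<noteq> {}"
    and summands: "\<And>s. s \<in> steps n S \<Longrightarrow> \<exists>t\<in>costeps n S. \<exists>r\<in>costeps n S. s = (t + r) mod n"
  defines "G \<equiv> complement_graph (circulant_graph n S)"
  shows "\<exists>R. routing G R \<and> max_edge_load G R \<le> 2 + 3 * card (steps n S)"
proof -
  have "0 < n"
    using nonempty by (auto simp: costeps_def)
  let ?D = "steps n S" and ?T = "costeps n S"
  let ?f = "\<lambda>(x, d). (x, (x + d) mod n)"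
  obtain t r where tr: "\<And>s. s \<in> ?D \<Longrightarrow> t s \<in> ?T \<and> r s \<in> ?T \<and> s = (t s + r s) mod n"
    using summands by metis
  have D_bounds: "?D \<subseteq> {1..<n}"
    by (rule steps_bounds[OF S])
  then have finD: "finite ?D"
    by (rule finite_subset) simp
  have T_bounds: "?T \<subseteq> {1..<n}"
    by (auto simp: costeps_def)
  have arcs: "parcs G = ?f ` ({0..<n} \<times> ?T)"
    unfolding G_def by (rule parcs_complement_circulant[OF S])
  have arcI: "(x, (x + d) mod n) \<in> parcs G" if "x < n" "d \<in> ?T" for x d
    unfolding arcs using that by (intro rev_image_eqI[of "(x, d)"]) auto
  have verts: "pverts G = {0..<n}"
    by (simp add: G_def complement_graph_def circulant_graph_def)
  define diff where "diff = (\<lambda>x y. (y + n - x) mod n)"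
  define R where "R = (\<lambda>x y. if (x, y) \<in> parcs G then [x, y]
    else [x, (x + t (diff x y)) mod n, y])"
  have nonadj: "\<exists>s\<in>?D. y = (x + s) mod n \<and> diff x y = s"
    if "x < n" "y < n" "x \<noteq> y" "(x, y) \<notin> parcs G" for x y
  proof -
    have "(x, y) \<in> ?f ` ({0..<n} \<times> {1..<n})"
      unfolding translation_onto using that by simp
    then obtain s where s: "s \<in> {1..<n}" "y = (x + s) mod n"
      by auto
    have "s \<in> ?D"
      using s arcI[OF that(1), of s] that(4) by (auto simp: costeps_def)
    moreover have "diff x y = s"
      using s that(1) by (auto simp: diff_def mod_if)
    ultimately show ?thesis
      using s(2) by blast
  qed
  have R: "routing G R"
    unfolding routing_def
  proof (intro ballI impI)
    fix x y assume "x \<in> pverts G" "y \<in> pverts G" and neq: "x \<noteq> y"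
    then have xy: "x < n" "y < n"
      by (auto simp: verts)
    show "vpath (R x y) (with_proj G) \<and> hd (R x y) = x \<and> last (R x y) = y"
    proof (cases "(x, y) \<in> parcs G")
      case True
      then show ?thesis
        using xy neq by (auto simp: R_def vpath_def vwalk_def verts)
    next
      case False
      then obtain s where s: "s \<in> ?D" "y = (x + s) mod n" "diff x y = s"
        using nonadj xy neq by blast
      define w where "w = (x + t s) mod n"
      have ts: "t s \<in> ?T" "r s \<in> ?T" "s = (t s + r s) mod n"
        using tr s(1) by auto
      have wy: "y = (w + r s) mod n"
        unfolding w_def s(2) by (subst ts(3)) (simp add: mod_simps add.assoc)
      have w: "w < n"
        using \<open>0 < n\<close> by (simp add: w_def)
      have 1: "(x, w) \<in> parcs G"
        unfolding w_def using arcI xy(1) ts(1) by blast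
      have 2: "(w, y) \<in> parcs G"
        unfolding wy using arcI w ts(2) by blast
      have "x \<noteq> w" "w \<noteq> y"
        using 1 2 by (auto simp: G_def complement_graph_def)
      then show ?thesis
        using False 1 2 xy w neq
        by (simp add: R_def s(3) w_def[symmetric] vpath_def vwalk_def verts)
    qed
  qed
  have "edge_load G R e \<le> 2 + 3 * card ?D" if edge: "e \<in> undirected_edges G" for e
  proof -
    obtain u v where e: "e = {u, v}" "(u, v) \<in> parcs G"
      using edge by (auto simp: undirected_edges_def)
    have uv: "u < n" "v < n"
      using e(2) by (auto simp: G_def complement_graph_def circulant_graph_def)
    \<comment> \<open>\<open>X s\<close> collects the start vertices of the paths for the difference \<open>s\<close> that use \<open>e\<close>,
      \<open>Y\<close> the pairs joined by these paths.\<close>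
    define X where "X = (\<lambda>s. {x \<in> {0..<n}. {x, (x + t s) mod n} = {u, v}
      \<or> {(x + t s) mod n, (x + s) mod n} = {u, v}})"
    define Y where "Y = (\<Union>s\<in>?D. (\<lambda>x. (x, (x + s) mod n)) ` X s)"
    have finX: "finite (X s)" for s
      by (simp add: X_def)
    have "{(x, y). x \<in> pverts G \<and> y \<in> pverts G \<and> x \<noteq> y \<and>
        (\<exists>(u, v) \<in> set (vwalk_arcs (R x y)). {u, v} = e)} \<subseteq> {(u, v), (v, u)} \<union> Y"
    proof (intro subsetI)
      fix p assume "p \<in> {(x, y). x \<in> pverts G \<and> y \<in> pverts G \<and> x \<noteq> y \<and>
        (\<exists>(u, v) \<in> set (vwalk_arcs (R x y)). {u, v} = e)}"
      then obtain x y u' v' where p: "p = (x, y)" "x < n" "y < n" "x \<noteq> y"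
        and uses: "(u', v') \<in> set (vwalk_arcs (R x y))" "{u', v'} = {u, v}"
        by (auto simp: verts e(1))
      show "p \<in> {(u, v), (v, u)} \<union> Y"
      proof (cases "(x, y) \<in> parcs G")
        case True
        then have "R x y = [x, y]"
          by (simp add: R_def)
        then have "{x, y} = {u, v}"
          using uses by simp
        then show ?thesis
          using p(1) by (auto simp: doubleton_eq_iff)
      next
        case False
        then obtain s where s: "s \<in> ?D" "y = (x + s) mod n" "diff x y = s"
          using nonadj p(2-4) by blast
        have "R x y = [x, (x + t s) mod n, (x + s) mod n]"
          using False by (simp add: R_def s(3) flip: s(2))
        then have "x \<in> X s"
          using uses p(2) by (auto simp: X_def)
        then show ?thesis
          using s p(1) by (auto simp: Y_def)
      qed
    qed
    moreover have "finite ({(u, v), (v, u)} \<union> Y)"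
      using finD finX by (simp add: Y_def)
    ultimately have "edge_load G R e \<le> card ({(u, v), (v, u)} \<union> Y)"
      unfolding edge_load_def by (intro card_mono)
    moreover have "card ({(u, v), (v, u)} \<union> Y) \<le> card {(u, v), (v, u)} + card Y"
      by (rule card_Un_le)
    moreover have "card {(u, v), (v, u)} \<le> 2"
      by (cases "u = v") simp_all
    moreover have "card Y \<le> (\<Sum>s\<in>?D. card ((\<lambda>x. (x, (x + s) mod n)) ` X s))"
      unfolding Y_def by (rule card_UN_le[OF finD])
    moreover have "(\<Sum>s\<in>?D. card ((\<lambda>x. (x, (x + s) mod n)) ` X s)) \<le> (\<Sum>s\<in>?D. 3)"
    proof (rule sum_mono)
      fix s assume s: "s \<in> ?D"
      have "s \<in> {1..<n}" "t s \<in> {1..<n}"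
        using s D_bounds T_bounds tr[OF s] by blast+
      then have "card (X s) \<le> 3"
        unfolding X_def using uv by (intro two_step_load_one_difference) simp_all
      then show "card ((\<lambda>x. (x, (x + s) mod n)) ` X s) \<le> 3"
        by (rule order_trans[OF card_image_le[OF finX]])
    qed
    ultimately show ?thesis
      by simp
  qed
  moreover have "finite (undirected_edges G)" "undirected_edges G \<noteq> {}"
    using T_bounds nonempty \<open>0 < n\<close> finite_subset[OF T_bounds]
    by (auto simp: undirected_edges_eq_image arcs)
  ultimately have "max_edge_load G R \<le> 2 + 3 * card ?D"
    by (simp add: max_edge_load_def)
  then show ?thesis
    using R by blast
qed

section \<open>The complement of a circulant graph with two generators\<close>

theorem corollary4p8:
  fixes n a :: nat
  assumes "n \<ge> 8"
    and "2 \<le> a" and "real a < real n / 2"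
    and "(n, a) \<noteq> (8, 3)"
  defines "\<Gamma>' \<equiv> complement_graph (circulant_graph n {1, a})"
  shows "2 * (real n + 3) / (real n - 5) \<le> real (edge_forwarding_index \<Gamma>')
    \<and> edge_forwarding_index \<Gamma>' \<le> 14"
proof -
  let ?S = "{1, a}"
  have a: "2 * a < n"
    using assms(3) by linarith
  have S: "?S \<subseteq> {1..<n}"
    using a assms(1,2) by auto
  have steps: "steps n ?S = {1, a, n - 1, n - a}"
    by (auto simp: steps_def)
  have card4: "card (steps n ?S) = 4"
    unfolding steps using a assms(1,2) by (simp add: card_insert_if) arith
  have summands: "\<exists>t\<in>costeps n ?S. \<exists>r\<in>costeps n ?S. s = (t + r) mod n" if s: "s \<in> steps n ?S" for s
  proof (cases "n = 8")
    case False
    then show ?thesis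
      using step_eq_sum_of_costeps[OF S _ s] card4 assms(1) by simp
  next
    case True
    have "a = 2"
      using True a assms(2,4) by auto
    have "costeps n ?S = {3, 4, 5}"
      unfolding costeps_def steps using True \<open>a = 2\<close> by auto
    moreover have "s \<in> {1, 2, 7, 6}"
      using s True \<open>a = 2\<close> unfolding steps by simp
    ultimately show ?thesis
      using True by auto
  qed
  have "costeps n ?S \<noteq> {}"
    using summands[of 1] unfolding steps by blast
  then obtain R where R: "routing \<Gamma>' R" "max_edge_load \<Gamma>' R \<le> 14"
    using exists_routing_complement_circulant[OF S _ summands] card4
    unfolding \<Gamma>'_def by auto
  have upper: "edge_forwarding_index \<Gamma>' \<le> 14"
    using edge_forwarding_index_attained(2)[OF R(1)] R(2) by simp
  interpret pair_graph \<Gamma>'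
    unfolding \<Gamma>'_def by (intro pair_graph_complement_graph pair_graph_circulant_graph S)
  \<comment> \<open>The counting bound applies to an optimal routing, which exists because \<open>R\<close> is a routing.\<close>
  define M where "M = edge_forwarding_index \<Gamma>'"
  obtain R' where R': "routing \<Gamma>' R'" "max_edge_load \<Gamma>' R' = M"
    using edge_forwarding_index_attained(1)[OF R(1)] M_def by auto
  have "card (pverts \<Gamma>') = n"
    by (simp add: \<Gamma>'_def complement_graph_def circulant_graph_def)
  moreover have "card (parcs \<Gamma>') = n * (n - 5)"
    unfolding \<Gamma>'_def card_parcs_complement_circulant[OF S] card4 by simp
  ultimately have "n * (4 * (n - 1)) \<le> n * ((n - 5) * (M + 2))"
    using edge_load_lower_bound[OF R'(1)] R'(2) by (simp add: mult_ac)
  then have "4 * (n - 1) \<le> (n - 5) * (M + 2)"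
    using assms(1) by simp
  then have "real (4 * (n - 1)) \<le> real ((n - 5) * (M + 2))"
    by (rule of_nat_mono)
  then have "4 * (real n - 1) \<le> (real n - 5) * (real M + 2)"
    using assms(1) by (simp only: of_nat_mult of_nat_add of_nat_diff) (simp add: of_nat_diff)
  then have "2 * (real n + 3) \<le> real M * (real n - 5)"
    by (simp add: algebra_simps)
  then have "2 * (real n + 3) / (real n - 5) \<le> real M"
    using assms(1) by (subst pos_divide_le_eq) simp_all
  then show ?thesis
    using upper by (simp add: M_def)
qed

end
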